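(* Let $G$ be both a groupoid and a topological space (no compatibility assumed) whose unit space $G^0$ is Hausdorff. (1) Let $Y$ be a unital $1$-cancellative semigroup. If $S\subseteq{}_Y\mathcal{B}^\circ(G)$ is a bumpy semigroup, then $G$ is locally compact and étale. (2) Conversely, if $G$ is locally compact and étale, then $$S=\bigcup_{O\in\mathcal{B}^\circ(G)}C_0(O,\mathbb{D}\setminus\{0\})\ \subseteq\ {}_{\mathbb{D}\setminus\{0\}}\mathcal{B}^\circ(G)$$ is a bumpy semigroup (with $Y=\mathbb{D}\setminus\{0\}$ under multiplication).
   Context: For a groupoid $G$: $\mathsf{s}(g)=g^{-1}g$, $\mathsf{r}(g)=gg^{-1}$; $G^0$ is the set of units (with the subspace topology); $gh$ is defined iff $\mathsf{s}(g)=\mathsf{r}(h)$; for $X,X'\subseteq G$, $XX'=\{xx':x\in X,x'\in X',\mathsf{s}(x)=\mathsf{r}(x')\}$ and $X^{-1}=\{x^{-1}:x\in X\}$. A bisection is $B\subseteq G$ with $BB^{-1}\cup B^{-1}B\subseteq G^0$. $\mathcal{O}(G)$ is the topology of $G$, and $\mathcal{B}^\circ(G)$ is the set of open bisections. $\mathrm{int}$ denotes interior in $G$. $G$ is étale if inversion and multiplication are continuous (on $G$ and on the set of composable pairs) and $\mathsf{s}$ is a local homeomorphism onto an open subset of $G$. Locally compact means that every point has a neighbourhood base of compact sets (compact sets need not be Hausdorff). A unital semigroup $Y$ is $1$-cancellative if for all $x,y\in Y$: $xy=x\Leftrightarrow y=1\Leftrightarrow yx=x$. $Y^\times$ denotes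 its invertible elements. For a family $\mathcal{X}$ of subsets of $G$, ${}_Y\mathcal{X}$ is the set of partial functions $a$ from $G$ to $Y$ with domain $\mathrm{dom}(a)\in\mathcal{X}$. For $W\subseteq Y$, $[W]a=\{g\in\mathrm{dom}(a):a(g)\in W\}$, and $[1]a=[\{1\}]a$. If $\mathrm{dom}(a)$ or $\mathrm{dom}(b)$ is a bisection, the product $ab$ is the function with domain $\mathrm{dom}(a)\mathrm{dom}(b)$ given by $ab(gh)=a(g)b(h)$ for $g\in\mathrm{dom}(a)$, $h\in\mathrm{dom}(b)$, $\mathsf{s}(g)=\mathsf{r}(h)$; semigroups of functions carry this product. $S\subseteq{}_Y\mathcal{B}^\circ(G)$ is bumpy if: (1-Proper) $[1]a$ is compact for all $a\in S$; (Urysohn) the empty function $\emptyset$ is in $S$, and whenever $g\in O\in\mathcal{O}(G)$ there is $a\in S$ with $\mathrm{dom}(a)\subseteq O$ and $g\in\mathrm{int}([Y^\times]a)$; (Involutive) whenever $a\in S$ and $g\in\mathrm{int}([Y^\times]a)$, there is $b\in S$ with $g^{-1}\in\mathrm{int}(\{h\in G:a(h^{-1})=b(h)^{-1}\})$. A bumpy semigroup is a bumpy $S$ that is closed under the product. $\mathbb{D}=\{z\in\mathbb{C}:|z|\le1\}$. $C_0(O,\mathbb{D}\setminus\{0\})$ is the set of continuous functions $a:O\to\mathbb{D}\setminus\{0\}$ vanishing at infinity on $O$, i.e. $\{g\in O:|a(g)|\ge\epsilon\}$ is compact for every $\epsilon>0$. *)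

theory Defs
  imports "HOL-Analysis.Analysis" "HOL-Algebra.Group"
begin

section \<open>Groupoids carrying a topology\<close>

text \<open>The elements of the groupoid are the points of the topology, \<open>topspace (gtop G)\<close>.
  The values of \<open>gmult\<close> outside the composable pairs are irrelevant.\<close>

record 'g topologised_groupoid =
  gtop :: "'g topology"
  gmult :: "'g \<Rightarrow> 'g \<Rightarrow> 'g"
  ginv :: "'g \<Rightarrow> 'g"

abbreviation arrows :: "'g topologised_groupoid \<Rightarrow> 'g set" where
  "arrows G \<equiv> topspace (gtop G)"

definition src :: "'g topologised_groupoid \<Rightarrow> 'g \<Rightarrow> 'g" where
  "src G g = gmult G (ginv G g) g"

definition rng :: "'g topologised_groupoid \<Rightarrow> 'g \<Rightarrow> 'g" where
  "rng G g = gmult G g (ginv G g)"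

definition composable :: "'g topologised_groupoid \<Rightarrow> ('g \<times> 'g) set" where
  "composable G = {(g, h). g \<in> arrows G \<and> h \<in> arrows G \<and> src G g = rng G h}"

text \<open>The usual (Hahn--Renault) axioms of a groupoid.  No axiom relates the algebra to the
  topology.\<close>

locale groupoid =
  fixes G :: "'g topologised_groupoid"
  assumes inv_closed: "g \<in> arrows G \<Longrightarrow> ginv G g \<in> arrows G"
    and inv_inv: "g \<in> arrows G \<Longrightarrow> ginv G (ginv G g) = g"
    and mult_closed: "(g, h) \<in> composable G \<Longrightarrow> gmult G g h \<in> arrows G"
    and composable_left:
      "\<lbrakk>(g, h) \<in> composable G; (h, k) \<in> composable G\<rbrakk> \<Longrightarrow> (gmult G g h, k) \<in> composable G"
    and composable_right:
      "\<lbrakk>(g, h) \<in> composable G; (h, k) \<in> composable G\<rbrakk> \<Longrightarrow> (g, gmult G h k) \<in> composable G"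
    and assoc: "\<lbrakk>(g, h) \<in> composable G; (h, k) \<in> composable G\<rbrakk>
      \<Longrightarrow> gmult G (gmult G g h) k = gmult G g (gmult G h k)"
    and inv_mult_cancel:
      "(g, h) \<in> composable G \<Longrightarrow> gmult G (ginv G g) (gmult G g h) = h"
    and mult_inv_cancel:
      "(g, h) \<in> composable G \<Longrightarrow> gmult G (gmult G g h) (ginv G h) = g"

definition unit_space :: "'g topologised_groupoid \<Rightarrow> 'g set" where
  "unit_space G = src G ` arrows G"

definition set_prod :: "'g topologised_groupoid \<Rightarrow> 'g set \<Rightarrow> 'g set \<Rightarrow> 'g set" where
  "set_prod G A B = {gmult G g h | g h. g \<in> A \<and> h \<in> B \<and> src G g = rng G h}"

definition bisection :: "'g topologised_groupoid \<Rightarrow> 'g set \<Rightarrow> bool" where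
  "bisection G B \<longleftrightarrow> B \<subseteq> arrows G \<and>
     set_prod G B (ginv G ` B) \<union> set_prod G (ginv G ` B) B \<subseteq> unit_space G"

definition open_bisections :: "'g topologised_groupoid \<Rightarrow> 'g set set" where
  "open_bisections G = {B. openin (gtop G) B \<and> bisection G B}"

definition local_homeomorphism :: "'a topology \<Rightarrow> 'b topology \<Rightarrow> ('a \<Rightarrow> 'b) \<Rightarrow> bool" where
  "local_homeomorphism X Z f \<longleftrightarrow> f \<in> topspace X \<rightarrow> topspace Z \<and>
     (\<forall>x\<in>topspace X. \<exists>U. openin X U \<and> x \<in> U \<and> openin Z (f ` U) \<and>
        homeomorphic_map (subtopology X U) (subtopology Z (f ` U)) f)"

text \<open>The image of the source map is \<open>unit_space G\<close> by definition.\<close>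

definition etale :: "'g topologised_groupoid \<Rightarrow> bool" where
  "etale G \<longleftrightarrow>
     continuous_map (gtop G) (gtop G) (ginv G) \<and>
     continuous_map (subtopology (prod_topology (gtop G) (gtop G)) (composable G)) (gtop G)
       (\<lambda>(g, h). gmult G g h) \<and>
     openin (gtop G) (unit_space G) \<and>
     local_homeomorphism (gtop G) (subtopology (gtop G) (unit_space G)) (src G)"

text \<open>Without the Hausdorff property this is stronger than \<open>locally_compact_space\<close>, which only
  asks for one compact neighbourhood of each point.\<close>

definition locally_compact :: "'g topologised_groupoid \<Rightarrow> bool" where
  "locally_compact G \<longleftrightarrow> neighbourhood_base_of (compactin (gtop G)) (gtop G)"

section \<open>Partial functions with values in a unital semigroup\<close>

definition one_cancellative :: "('y, 'm) monoid_scheme \<Rightarrow> bool" where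
  "one_cancellative Y \<longleftrightarrow> (\<forall>x\<in>carrier Y. \<forall>y\<in>carrier Y.
     (x \<otimes>\<^bsub>Y\<^esub> y = x \<longleftrightarrow> y = \<one>\<^bsub>Y\<^esub>) \<and> (y = \<one>\<^bsub>Y\<^esub> \<longleftrightarrow> y \<otimes>\<^bsub>Y\<^esub> x = x))"

definition partial_functions :: "('y, 'm) monoid_scheme \<Rightarrow> 'g set set \<Rightarrow> ('g \<rightharpoonup> 'y) set" where
  "partial_functions Y \<X> = {a. dom a \<in> \<X> \<and> ran a \<subseteq> carrier Y}"

definition level :: "'y set \<Rightarrow> ('g \<rightharpoonup> 'y) \<Rightarrow> 'g set" where
  "level W a = {g. \<exists>y\<in>W. a g = Some y}"

text \<open>The value at \<open>k = gh\<close> does not depend on the factorisation as soon as one of the two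
  domains is a bisection; see \<open>pmult_eq\<close> below.\<close>

definition pmult ::
  "'g topologised_groupoid \<Rightarrow> ('y, 'm) monoid_scheme \<Rightarrow> ('g \<rightharpoonup> 'y) \<Rightarrow> ('g \<rightharpoonup> 'y) \<Rightarrow> ('g \<rightharpoonup> 'y)" where
  "pmult G Y a b = (\<lambda>k.
     if k \<in> set_prod G (dom a) (dom b)
     then Some (THE y. \<exists>g\<in>dom a. \<exists>h\<in>dom b. src G g = rng G h \<and> k = gmult G g h \<and>
                  y = the (a g) \<otimes>\<^bsub>Y\<^esub> the (b h))
     else None)"

section \<open>Bumpy semigroups\<close>

definition one_proper where
  "one_proper G Y S \<longleftrightarrow> (\<forall>a\<in>S. compactin (gtop G) (level {\<one>\<^bsub>Y\<^esub>} a))"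

definition urysohn where
  "urysohn G Y S \<longleftrightarrow> Map.empty \<in> S \<and>
     (\<forall>U g. openin (gtop G) U \<and> g \<in> U \<longrightarrow>
        (\<exists>a\<in>S. dom a \<subseteq> U \<and> g \<in> gtop G interior_of (level (Units Y) a)))"

text \<open>The equation \<open>a(h\<inverse>) = b(h)\<inverse>\<close> is read as: both sides are defined, i.e.\
  \<open>h\<inverse> \<in> dom a\<close>, \<open>h \<in> dom b\<close> and \<open>b(h)\<close> is invertible, and they are equal.\<close>

definition involutive where
  "involutive G Y S \<longleftrightarrow>
     (\<forall>a\<in>S. \<forall>g \<in> gtop G interior_of (level (Units Y) a). \<exists>b\<in>S.
        ginv G g \<in> gtop G interior_of
          {h \<in> arrows G. \<exists>y\<in>Units Y. b h = Some y \<and> a (ginv G h) = Some (inv\<^bsub>Y\<^esub> y)})"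

definition bumpy ::
  "'g topologised_groupoid \<Rightarrow> ('y, 'm) monoid_scheme \<Rightarrow> ('g \<rightharpoonup> 'y) set \<Rightarrow> bool" where
  "bumpy G Y S \<longleftrightarrow> S \<subseteq> partial_functions Y (open_bisections G) \<and>
     one_proper G Y S \<and> urysohn G Y S \<and> involutive G Y S"

definition bumpy_semigroup ::
  "'g topologised_groupoid \<Rightarrow> ('y, 'm) monoid_scheme \<Rightarrow> ('g \<rightharpoonup> 'y) set \<Rightarrow> bool" where
  "bumpy_semigroup G Y S \<longleftrightarrow> bumpy G Y S \<and> (\<forall>a\<in>S. \<forall>b\<in>S. pmult G Y a b \<in> S)"

definition punctured_disc :: "complex monoid" where
  "punctured_disc = \<lparr>carrier = {z. norm z \<le> 1} - {0}, mult = (*), one = 1\<rparr>"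

definition C0 :: "'g topologised_groupoid \<Rightarrow> 'g set \<Rightarrow> ('g \<rightharpoonup> complex) set" where
  "C0 G U = {a. dom a = U \<and> ran a \<subseteq> carrier punctured_disc \<and>
     continuous_map (subtopology (gtop G) U) euclidean (\<lambda>g. the (a g)) \<and>
     (\<forall>\<epsilon>>0. compactin (gtop G) {g \<in> U. norm (the (a g)) \<ge> \<epsilon>})}"

section \<open>Well-definedness\<close>

context groupoid
begin

lemma composable_inv_left: "g \<in> arrows G \<Longrightarrow> (ginv G g, g) \<in> composable G"
  and composable_inv_right: "g \<in> arrows G \<Longrightarrow> (g, ginv G g) \<in> composable G"
  by (auto simp: composable_def src_def rng_def inv_inv inv_closed)

lemma src_inv: "g \<in> arrows G \<Longrightarrow> src G (ginv G g) = rng G g"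
  and rng_inv: "g \<in> arrows G \<Longrightarrow> rng G (ginv G g) = src G g"
  by (simp_all add: src_def rng_def inv_inv)

lemma mult_src: "g \<in> arrows G \<Longrightarrow> gmult G g (src G g) = g"
  using inv_mult_cancel[OF composable_inv_left] by (simp add: inv_inv src_def)

lemma rng_mult_self: "g \<in> arrows G \<Longrightarrow> gmult G (rng G g) g = g"
  using mult_inv_cancel[OF composable_inv_right] by (simp add: inv_inv rng_def)

lemma src_closed: "g \<in> arrows G \<Longrightarrow> src G g \<in> arrows G"
  using mult_closed[OF composable_inv_left] by (simp add: src_def)

lemma rng_mult:
  assumes "(g, h) \<in> composable G" shows "rng G (gmult G g h) = rng G g"
proof -
  have gh: "g \<in> arrows G" "h \<in> arrows G" using assms by (auto simp: composable_def)
  have "(ginv G g, gmult G g h) \<in> composable G"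
    using composable_right[OF composable_inv_left[OF gh(1)] assms] .
  then show ?thesis using src_inv[OF gh(1)] by (simp add: composable_def)
qed

lemma src_mult:
  assumes "(g, h) \<in> composable G" shows "src G (gmult G g h) = src G h"
proof -
  have gh: "g \<in> arrows G" "h \<in> arrows G" using assms by (auto simp: composable_def)
  have "(gmult G g h, ginv G h) \<in> composable G"
    using composable_left[OF assms composable_inv_right[OF gh(2)]] .
  then show ?thesis using rng_inv[OF gh(2)] by (simp add: composable_def)
qed

lemma unit_absorb:
  assumes "u \<in> unit_space G" "(u, h) \<in> composable G" shows "gmult G u h = h"
proof -
  obtain x where x: "x \<in> arrows G" "u = src G x" using assms(1) by (auto simp: unit_space_def)
  have h: "h \<in> arrows G" using assms(2) by (auto simp: composable_def)
  have "src G u = src G x"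
    using src_mult[OF composable_inv_left[OF x(1)]] by (simp add: x(2) src_def[of G x])
  then have "(x, h) \<in> composable G" using assms(2) x h by (auto simp: composable_def)
  then show ?thesis
    using assoc[OF composable_inv_left[OF x(1)]] inv_mult_cancel by (simp add: x(2) src_def)
qed

lemma unit_absorb_right:
  assumes "u \<in> unit_space G" "(h, u) \<in> composable G" shows "gmult G h u = h"
proof -
  obtain x where x: "x \<in> arrows G" "u = src G x" using assms(1) by (auto simp: unit_space_def)
  have h: "h \<in> arrows G" using assms(2) by (auto simp: composable_def)
  have "rng G u = rng G (ginv G x)"
    using rng_mult[OF composable_inv_left[OF x(1)]] by (simp add: x(2) src_def[of G x])
  then have c: "(h, ginv G x) \<in> composable G"
    using assms(2) x h by (auto simp: composable_def inv_closed)
  show ?thesis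
    using assoc[OF c composable_inv_left[OF x(1)]] mult_inv_cancel[OF c]
    by (simp add: x inv_inv src_def)
qed

lemma bisection_rng_inj:
  assumes "bisection G B" "g \<in> B" "h \<in> B" "rng G g = rng G h" shows "g = h"
proof -
  have gh: "g \<in> arrows G" "h \<in> arrows G" using assms by (auto simp: bisection_def)
  have c: "(ginv G g, h) \<in> composable G"
    using assms(4) gh by (simp add: composable_def inv_closed src_inv)
  have u: "gmult G (ginv G g) h \<in> unit_space G"
    using assms c unfolding bisection_def set_prod_def composable_def by blast
  have c': "(g, gmult G (ginv G g) h) \<in> composable G"
    using composable_right[OF composable_inv_right[OF gh(1)] c] .
  show ?thesis
    using unit_absorb_right[OF u c'] inv_mult_cancel[OF c] by (simp add: inv_inv gh)
qed

lemma bisection_src_inj: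
  assumes "bisection G B" "g \<in> B" "h \<in> B" "src G g = src G h" shows "g = h"
proof -
  have gh: "g \<in> arrows G" "h \<in> arrows G" using assms by (auto simp: bisection_def)
  have c: "(g, ginv G h) \<in> composable G"
    using assms(4) gh by (simp add: composable_def inv_closed rng_inv)
  have u: "gmult G g (ginv G h) \<in> unit_space G"
    using assms c unfolding bisection_def set_prod_def composable_def by blast
  have c': "(gmult G g (ginv G h), h) \<in> composable G"
    using composable_left[OF c composable_inv_left[OF gh(2)]] .
  show ?thesis
    using unit_absorb[OF u c'] mult_inv_cancel[OF c] by (simp add: inv_inv gh)
qed

lemma pmult_eq:
  assumes ab: "dom a \<subseteq> arrows G" "dom b \<subseteq> arrows G"
    and bis: "bisection G (dom a) \<or> bisection G (dom b)"
    and gh: "a g = Some x" "b h = Some y" "src G g = rng G h"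
  shows "pmult G Y a b (gmult G g h) = Some (x \<otimes>\<^bsub>Y\<^esub> y)"
proof -
  have uniq: "g' = g \<and> h' = h"
    if "g' \<in> dom a" "h' \<in> dom b" "src G g' = rng G h'" "gmult G g h = gmult G g' h'" for g' h'
  proof -
    have c: "(g, h) \<in> composable G" "(g', h') \<in> composable G"
      using ab gh that by (auto simp: composable_def)
    have "rng G g = rng G g'" "src G h = src G h'"
      using rng_mult[OF c(1)] rng_mult[OF c(2)] src_mult[OF c(1)] src_mult[OF c(2)] that(4)
      by auto
    with bis have "g' = g \<or> h' = h"
      using bisection_rng_inj bisection_src_inj that gh by (metis domI)
    then show ?thesis
      using inv_mult_cancel c mult_inv_cancel that(4) by metis
  qed
  have "gmult G g h \<in> set_prod G (dom a) (dom b)"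
    using gh by (auto simp: set_prod_def)
  moreover have "(THE z. \<exists>g'\<in>dom a. \<exists>h'\<in>dom b. src G g' = rng G h' \<and>
      gmult G g h = gmult G g' h' \<and> z = the (a g') \<otimes>\<^bsub>Y\<^esub> the (b h')) = x \<otimes>\<^bsub>Y\<^esub> y"
  proof (rule the_equality)
    show "\<exists>g'\<in>dom a. \<exists>h'\<in>dom b. src G g' = rng G h' \<and>
      gmult G g h = gmult G g' h' \<and> x \<otimes>\<^bsub>Y\<^esub> y = the (a g') \<otimes>\<^bsub>Y\<^esub> the (b h')"
      using gh by (intro bexI[of _ g] bexI[of _ h]) auto
  next
    fix z
    assume "\<exists>g'\<in>dom a. \<exists>h'\<in>dom b. src G g' = rng G h' \<and>
      gmult G g h = gmult G g' h' \<and> z = the (a g') \<otimes>\<^bsub>Y\<^esub> the (b h')"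
    then show "z = x \<otimes>\<^bsub>Y\<^esub> y" using uniq gh by fastforce
  qed
  ultimately show ?thesis by (simp add: pmult_def)
qed

end

lemma monoid_punctured_disc: "monoid punctured_disc"
  by (rule monoidI) (auto simp: punctured_disc_def norm_mult mult_le_one)

lemma one_cancellative_punctured_disc: "one_cancellative punctured_disc"
  by (auto simp: one_cancellative_def punctured_disc_def)

end

theory Submission
  imports Defs
begin

text \<open>The two directions meet in a description of etale groupoids without continuity: \<open>G\<close> is etale
  iff its open bisections cover it and both inverses and products of open sets are open
  (\<open>etale_if_open_operations\<close>, \<open>open_operations_if_etale\<close>).  Here is why openness suffices.  The
  preimage of an open set \<open>W\<close> under the source map is the product of the set of all arrows with the
  units in \<open>W\<close>.  The source image of an open bisection \<open>B\<close> is the open set \<open>B\<inverse>B\<close>.  And if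
  \<open>g \<in> B\<close> then \<open>gh \<in> W\<close> amounts to \<open>h \<in> B\<inverse>W\<close>, so multiplication is continuous.

  For a bumpy semigroup, the domains of its functions form a basis by (Urysohn), and a product of
  two of them is again such a domain, so products of open sets are open; (Involutive) makes inverses
  of open sets open.  For local compactness, take a unit \<open>u\<close>, some \<open>a\<close> that is invertible near \<open>u\<close>
  and some \<open>b\<close> that inverts it near \<open>u\<close>.  At units near \<open>u\<close> the product \<open>ab\<close> has the value \<open>1\<close>, and
  \<open>[1](ab)\<close> is compact.  This set may leave the unit space, and if \<open>G\<close> is not Hausdorff its
  intersection with the unit space may fail to be compact; but its image under the source map is
  compact, consists of units and contains all units near \<open>u\<close>.  The Hausdorff unit space is therefore
  locally compact, and the source map carries this over to each open bisection.

  Conversely, an open bisection of a locally compact etale groupoid is homeomorphic to an open set of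
  units, hence locally compact Hausdorff, and this yields the bump functions.  The adjoint
  \<open>h \<mapsto> cnj (a (h\<inverse>))\<close> serves as the local inverse, because the invertible elements of the punctured
  disc form the unit circle.  A product \<open>ab\<close> is continuous since products of open sets are open.  It
  vanishes at infinity since all values have modulus at most \<open>1\<close>: where \<open>|ab| \<ge> \<epsilon>\<close>, both
  factors have modulus at least \<open>\<epsilon>\<close>, and products of compact sets are compact
  (\<open>compactin_set_prod\<close>).\<close>

section \<open>Units, inverses and bisections\<close>

context groupoid
begin

lemma src_in_unit_space: "g \<in> arrows G \<Longrightarrow> src G g \<in> unit_space G"
  by (simp add: unit_space_def)

lemma rng_in_unit_space: "g \<in> arrows G \<Longrightarrow> rng G g \<in> unit_space G"
  unfolding unit_space_def using src_inv inv_closed by (metis imageI)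

lemma unit_space_subset_arrows: "unit_space G \<subseteq> arrows G"
  by (auto simp: unit_space_def src_closed)

lemma src_unit: "u \<in> unit_space G \<Longrightarrow> src G u = u"
  unfolding unit_space_def using src_mult composable_inv_left by (fastforce simp: src_def)

lemma rng_unit:
  assumes "u \<in> unit_space G" shows "rng G u = u"
proof -
  obtain x where x: "x \<in> arrows G" "u = src G x" using assms by (auto simp: unit_space_def)
  then have "rng G u = rng G (ginv G x)"
    using rng_mult[OF composable_inv_left[OF x(1)]] by (simp add: src_def)
  then show ?thesis using x by (simp add: rng_inv)
qed

lemma inv_unit:
  assumes "u \<in> unit_space G" shows "ginv G u = u"
proof -
  have u: "u \<in> arrows G" using assms unit_space_subset_arrows by blast
  have "gmult G (ginv G u) u = u" using src_unit[OF assms] by (simp add: src_def)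
  then show ?thesis using unit_absorb_right[OF assms composable_inv_left[OF u]] by simp
qed

lemma mult_unit_self: "u \<in> unit_space G \<Longrightarrow> gmult G u u = u"
  using mult_src[of u] unit_space_subset_arrows src_unit by fastforce

lemma left_quotient:
  assumes "g \<in> arrows G" "k \<in> arrows G" "rng G g = rng G k"
  shows "(ginv G g, k) \<in> composable G"
    and "(g, gmult G (ginv G g) k) \<in> composable G"
    and "gmult G g (gmult G (ginv G g) k) = k"
proof -
  show c: "(ginv G g, k) \<in> composable G"
    using assms by (simp add: composable_def inv_closed src_inv)
  show "(g, gmult G (ginv G g) k) \<in> composable G"
    using composable_right[OF composable_inv_right[OF assms(1)] c] .
  show "gmult G g (gmult G (ginv G g) k) = k"
    using inv_mult_cancel[OF c] assms(1) by (simp add: inv_inv)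
qed

lemma set_prodI:
  "\<lbrakk>g \<in> A; h \<in> B; src G g = rng G h\<rbrakk> \<Longrightarrow> gmult G g h \<in> set_prod G A B"
  by (auto simp: set_prod_def)

lemma set_prodE:
  assumes "k \<in> set_prod G A B" "A \<subseteq> arrows G" "B \<subseteq> arrows G"
  obtains g h where "g \<in> A" "h \<in> B" "(g, h) \<in> composable G" "k = gmult G g h"
  using assms by (auto simp: set_prod_def composable_def)

lemma set_prod_subset_arrows:
  "\<lbrakk>A \<subseteq> arrows G; B \<subseteq> arrows G\<rbrakk> \<Longrightarrow> set_prod G A B \<subseteq> arrows G"
  by (auto elim!: set_prodE simp: mult_closed)

lemma inv_image_subset: "A \<subseteq> arrows G \<Longrightarrow> ginv G ` A \<subseteq> arrows G"
  by (auto simp: inv_closed)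

lemma inv_image_iff:
  assumes "A \<subseteq> arrows G" "g \<in> arrows G" shows "g \<in> ginv G ` A \<longleftrightarrow> ginv G g \<in> A"
proof
  show "g \<in> ginv G ` A \<Longrightarrow> ginv G g \<in> A" using assms(1) by (auto simp: inv_inv subset_iff)
  show "g \<in> ginv G ` A" if "ginv G g \<in> A"
    using imageI[OF that, of "ginv G"] inv_inv[OF assms(2)] by simp
qed

lemma inv_image_eq_preimage:
  assumes "A \<subseteq> arrows G" shows "ginv G ` A = {g \<in> arrows G. ginv G g \<in> A}"
proof (rule Set.set_eqI)
  fix g
  show "g \<in> ginv G ` A \<longleftrightarrow> g \<in> {g \<in> arrows G. ginv G g \<in> A}"
    using inv_image_iff[OF assms, of g] inv_image_subset[OF assms] by auto
qed

lemma bisection_iff: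
  "bisection G B \<longleftrightarrow> B \<subseteq> arrows G \<and> inj_on (src G) B \<and> inj_on (rng G) B"
proof
  assume "bisection G B"
  then show "B \<subseteq> arrows G \<and> inj_on (src G) B \<and> inj_on (rng G) B"
    using bisection_src_inj bisection_rng_inj by (auto simp: bisection_def inj_on_def)
next
  assume B: "B \<subseteq> arrows G \<and> inj_on (src G) B \<and> inj_on (rng G) B"
  have "gmult G g (ginv G h) \<in> unit_space G"
    if "g \<in> B" "h \<in> B" "src G g = rng G (ginv G h)" for g h
  proof -
    have gh: "g \<in> arrows G" "h \<in> arrows G" using that B by auto
    then have "g = h" using that B by (auto simp: rng_inv dest: inj_onD)
    then show ?thesis using rng_in_unit_space gh by (simp add: rng_def)
  qed
  moreover have "gmult G (ginv G g) h \<in> unit_space G"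
    if "g \<in> B" "h \<in> B" "src G (ginv G g) = rng G h" for g h
  proof -
    have gh: "g \<in> arrows G" "h \<in> arrows G" using that B by auto
    then have "g = h" using that B by (auto simp: src_inv dest: inj_onD)
    then show ?thesis using src_in_unit_space gh by (simp add: src_def)
  qed
  ultimately show "bisection G B" using B by (auto simp: bisection_def set_prod_def)
qed

lemma bisection_subset: "\<lbrakk>bisection G B; A \<subseteq> B\<rbrakk> \<Longrightarrow> bisection G A"
  unfolding bisection_iff by (meson inj_on_subset order_trans)

lemma bisection_inv:
  assumes "bisection G B" shows "bisection G (ginv G ` B)"
proof -
  have B: "B \<subseteq> arrows G" using assms by (simp add: bisection_def)
  have "g = h" if "g \<in> B" "h \<in> B"
    "src G (ginv G g) = src G (ginv G h) \<or> rng G (ginv G g) = rng G (ginv G h)" for g h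
  proof -
    have "rng G g = rng G h \<or> src G g = src G h"
      using that(3) B that(1,2) by (simp add: src_inv rng_inv subset_iff)
    then show ?thesis using bisection_rng_inj bisection_src_inj assms that(1,2) by blast
  qed
  then show ?thesis
    using inv_image_subset[OF B] unfolding bisection_iff inj_on_def by blast
qed

lemma bisection_set_prod:
  assumes "bisection G A" "bisection G B" shows "bisection G (set_prod G A B)"
proof -
  have AB: "A \<subseteq> arrows G" "B \<subseteq> arrows G" using assms by (auto simp: bisection_def)
  have "k = k'" if k: "k \<in> set_prod G A B" "k' \<in> set_prod G A B"
    and eq: "src G k = src G k' \<or> rng G k = rng G k'" for k k'
  proof -
    obtain g h where gh: "g \<in> A" "h \<in> B" "(g, h) \<in> composable G" "k = gmult G g h"
      using set_prodE[OF k(1) AB] .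
    obtain g' h' where gh': "g' \<in> A" "h' \<in> B" "(g', h') \<in> composable G" "k' = gmult G g' h'"
      using set_prodE[OF k(2) AB] .
    have s: "src G g = rng G h" "src G g' = rng G h'" using gh gh' by (auto simp: composable_def)
    have "src G h = src G h' \<or> rng G g = rng G g'"
      using eq gh gh' src_mult rng_mult by metis
    then have "g = g' \<and> h = h'"
      using s gh gh' assms bisection_src_inj bisection_rng_inj by metis
    then show ?thesis using gh gh' by simp
  qed
  then show ?thesis
    using set_prod_subset_arrows[OF AB] unfolding bisection_iff inj_on_def by blast
qed

text \<open>This turns openness of products into openness of the source map.\<close>

lemma src_image_bisection:
  assumes "bisection G B" shows "set_prod G (ginv G ` B) B = src G ` B"
proof -
  have B: "B \<subseteq> arrows G" "inj_on (rng G) B" using assms by (auto simp: bisection_iff)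
  show ?thesis
  proof
    show "set_prod G (ginv G ` B) B \<subseteq> src G ` B"
    proof
      fix k assume "k \<in> set_prod G (ginv G ` B) B"
      then obtain g h where gh: "g \<in> B" "h \<in> B" "src G (ginv G g) = rng G h"
        "k = gmult G (ginv G g) h" by (auto simp: set_prod_def)
      then have "rng G g = rng G h" using B src_inv by (metis subsetD)
      then have "g = h" using gh B by (meson inj_onD)
      then show "k \<in> src G ` B" using gh by (auto simp: src_def)
    qed
    show "src G ` B \<subseteq> set_prod G (ginv G ` B) B"
    proof
      fix k assume "k \<in> src G ` B"
      then obtain g where "g \<in> B" "k = gmult G (ginv G g) g" by (auto simp: src_def)
      then show "k \<in> set_prod G (ginv G ` B) B" using B by (auto intro!: set_prodI simp: src_inv)
    qed
  qed
qed

section \<open>Groupoids with open operations\<close>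

text \<open>Equivalent to being etale, but phrased without continuity, so that it can be checked on a basis of
  the topology.\<close>

definition open_operations :: bool where
  "open_operations \<longleftrightarrow>
     (\<forall>U. openin (gtop G) U \<longrightarrow> openin (gtop G) (ginv G ` U)) \<and>
     (\<forall>U V. openin (gtop G) U \<longrightarrow> openin (gtop G) V \<longrightarrow> openin (gtop G) (set_prod G U V)) \<and>
     arrows G \<subseteq> \<Union> (open_bisections G)"

lemma open_bisection_arrows: "B \<in> open_bisections G \<Longrightarrow> B \<subseteq> arrows G"
  by (auto simp: open_bisections_def openin_subset dest: openin_subset)

lemma open_bisection_restrict:
  "\<lbrakk>B \<in> open_bisections G; openin (gtop G) U\<rbrakk> \<Longrightarrow> U \<inter> B \<in> open_bisections G"
  by (auto simp: open_bisections_def intro: bisection_subset)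

lemma open_bisection_basis:
  assumes "open_operations" "openin (gtop G) U" "g \<in> U"
  obtains B where "B \<in> open_bisections G" "g \<in> B" "B \<subseteq> U"
proof -
  obtain B where "B \<in> open_bisections G" "g \<in> B"
    using assms(1) subsetD[OF openin_subset[OF assms(2)] assms(3)] by (auto simp: open_operations_def)
  then show thesis using that[of "U \<inter> B"] open_bisection_restrict[OF _ assms(2)] assms(3) by auto
qed

lemma open_map_src:
  assumes "open_operations" shows "open_map (gtop G) (gtop G) (src G)"
  unfolding open_map_def
proof (intro allI impI)
  fix U assume U: "openin (gtop G) U"
  have "openin (gtop G) (src G ` (U \<inter> B))" if "B \<in> open_bisections G" for B
    using open_bisection_restrict[OF that U] assms src_image_bisection
    unfolding open_operations_def open_bisections_def by force
  then have "openin (gtop G) (\<Union>B\<in>open_bisections G. src G ` (U \<inter> B))" by blast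
  moreover have "(\<Union>B\<in>open_bisections G. U \<inter> B) = U"
    using assms openin_subset[OF U] by (auto simp: open_operations_def)
  ultimately show "openin (gtop G) (src G ` U)" by (metis image_UN)
qed

lemma openin_unit_space: "open_operations \<Longrightarrow> openin (gtop G) (unit_space G)"
  using open_map_src unfolding open_map_def unit_space_def by blast

text \<open>Composing an arrow with a unit on the right changes nothing, so the arrows with source in \<open>W\<close>
  are exactly the products of an arrow with a unit in \<open>W\<close>.\<close>

lemma continuous_map_src:
  assumes "open_operations" shows "continuous_map (gtop G) (gtop G) (src G)"
  unfolding continuous_map_def
proof (intro conjI allI impI)
  show "src G \<in> arrows G \<rightarrow> arrows G" by (auto simp: src_closed)
  fix W assume W: "openin (gtop G) W"
  have "{g \<in> arrows G. src G g \<in> W} = set_prod G (arrows G) (W \<inter> unit_space G)"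
  proof (intro equalityI subsetI)
    fix g assume "g \<in> {g \<in> arrows G. src G g \<in> W}"
    then show "g \<in> set_prod G (arrows G) (W \<inter> unit_space G)"
      using set_prodI[of g "arrows G" "src G g" "W \<inter> unit_space G"]
      by (simp add: src_in_unit_space rng_unit mult_src)
  next
    fix g assume "g \<in> set_prod G (arrows G) (W \<inter> unit_space G)"
    then obtain x u where xu: "u \<in> W" "u \<in> unit_space G" "(x, u) \<in> composable G" "g = gmult G x u"
      using set_prodE[of g "arrows G" "W \<inter> unit_space G"] unit_space_subset_arrows by blast
    then show "g \<in> {g \<in> arrows G. src G g \<in> W}" by (simp add: mult_closed src_mult src_unit)
  qed
  then show "openin (gtop G) {g \<in> arrows G. src G g \<in> W}"
    using assms W openin_unit_space unfolding open_operations_def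
    by (simp add: openin_Int)
qed

lemma homeomorphic_map_src_bisection:
  assumes "open_operations" "B \<in> open_bisections G"
  shows "homeomorphic_map (subtopology (gtop G) B) (subtopology (gtop G) (src G ` B)) (src G)"
proof (rule bijective_open_imp_homeomorphic_map)
  have B: "openin (gtop G) B" "B \<subseteq> arrows G" "inj_on (src G) B"
    using assms(2) by (auto simp: open_bisections_def bisection_iff)
  show "continuous_map (subtopology (gtop G) B) (subtopology (gtop G) (src G ` B)) (src G)"
    using continuous_map_src[OF assms(1)]
    by (simp add: continuous_map_in_subtopology continuous_map_from_subtopology)
  show "open_map (subtopology (gtop G) B) (subtopology (gtop G) (src G ` B)) (src G)"
    using open_map_src[OF assms(1)] B(1)
    by (intro open_map_into_subtopology open_map_from_subtopology) auto
  show "src G ` topspace (subtopology (gtop G) B) = topspace (subtopology (gtop G) (src G ` B))"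
    using B src_closed by auto
  show "inj_on (src G) (topspace (subtopology (gtop G) B))"
    using B by (auto simp: inj_on_def)
qed

lemma continuous_map_inv:
  assumes "open_operations" shows "continuous_map (gtop G) (gtop G) (ginv G)"
  unfolding continuous_map_def
proof (intro conjI allI impI)
  show "ginv G \<in> arrows G \<rightarrow> arrows G" by (auto simp: inv_closed)
  fix U assume U: "openin (gtop G) U"
  then show "openin (gtop G) {g \<in> arrows G. ginv G g \<in> U}"
    using assms inv_image_eq_preimage[OF openin_subset[OF U]] unfolding open_operations_def by auto
qed

text \<open>If \<open>g\<close> lies in a bisection \<open>B\<close>, then \<open>gh \<in> W\<close> is equivalent to \<open>h \<in> B\<inverse>W\<close>: a witness
  \<open>h = b\<inverse>w\<close> has \<open>src b = rng h = src g\<close>, which forces \<open>b = g\<close>.  Hence the preimage of \<open>W\<close> is a union of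
  open rectangles.\<close>

lemma continuous_map_mult:
  assumes "open_operations"
  shows "continuous_map (subtopology (prod_topology (gtop G) (gtop G)) (composable G)) (gtop G)
    (\<lambda>(g, h). gmult G g h)"
    (is "continuous_map ?X _ ?m")
  unfolding continuous_map_def
proof (intro conjI allI impI)
  show "?m \<in> topspace ?X \<rightarrow> arrows G" by (auto simp: mult_closed)
  fix W assume W: "openin (gtop G) W"
  let ?P = "\<Union>B\<in>open_bisections G. B \<times> set_prod G (ginv G ` B) W"
  have "{p \<in> topspace ?X. ?m p \<in> W} = ?P \<inter> composable G"
  proof (intro equalityI subsetI)
    fix p assume "p \<in> {p \<in> topspace ?X. ?m p \<in> W}"
    then obtain g h where gh: "p = (g, h)" "(g, h) \<in> composable G" "gmult G g h \<in> W" by auto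
    then have g: "g \<in> arrows G" by (simp add: composable_def)
    then obtain B where B: "B \<in> open_bisections G" "g \<in> B"
      using assms by (auto simp: open_operations_def)
    have "gmult G (ginv G g) (gmult G g h) \<in> set_prod G (ginv G ` B) W"
      using B gh g by (intro set_prodI) (simp_all add: src_inv rng_mult)
    then show "p \<in> ?P \<inter> composable G" using B gh inv_mult_cancel by auto
  next
    fix p assume "p \<in> ?P \<inter> composable G"
    then obtain g h B where gh: "p = (g, h)" "(g, h) \<in> composable G"
      and B: "B \<in> open_bisections G" "g \<in> B" "h \<in> set_prod G (ginv G ` B) W" by auto
    then obtain b w where bw: "b \<in> B" "w \<in> W" "src G (ginv G b) = rng G w"
      "h = gmult G (ginv G b) w" by (auto simp: set_prod_def)
    have ba: "b \<in> arrows G" "w \<in> arrows G"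
      using bw B W open_bisection_arrows openin_subset by blast+
    then have "rng G b = rng G w" using bw by (simp add: src_inv)
    note q = left_quotient[OF ba this]
    have "src G g = src G b"
      using gh q(2) bw(4) by (auto simp: composable_def)
    then have "g = b" using B bw bisection_src_inj by (auto simp: open_bisections_def)
    then have "gmult G g h = w" using q bw by simp
    then show "p \<in> {p \<in> topspace ?X. ?m p \<in> W}" using gh bw by (auto simp: composable_def)
  qed
  moreover have "openin (prod_topology (gtop G) (gtop G)) ?P"
    using assms W
    by (intro openin_Union) (auto simp: openin_prod_Times_iff open_operations_def open_bisections_def)
  ultimately show "openin ?X {p \<in> topspace ?X. ?m p \<in> W}"
    unfolding openin_subtopology by blast
qed

lemma etale_if_open_operations:
  assumes "open_operations" shows "etale G"
proof -
  have "local_homeomorphism (gtop G) (subtopology (gtop G) (unit_space G)) (src G)"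
    unfolding local_homeomorphism_def
  proof (intro conjI ballI)
    show "src G \<in> arrows G \<rightarrow> topspace (subtopology (gtop G) (unit_space G))"
      by (auto simp: src_closed src_in_unit_space)
    fix g assume "g \<in> arrows G"
    then obtain B where B: "B \<in> open_bisections G" "g \<in> B"
      using assms by (auto simp: open_operations_def)
    have sB: "src G ` B \<subseteq> unit_space G"
      using open_bisection_arrows[OF B(1)] src_in_unit_space by blast
    have "openin (gtop G) B" "openin (gtop G) (src G ` B)"
      using B open_map_src[OF assms] by (auto simp: open_bisections_def open_map_def)
    with B sB show "\<exists>U. openin (gtop G) U \<and> g \<in> U \<and>
        openin (subtopology (gtop G) (unit_space G)) (src G ` U) \<and>
        homeomorphic_map (subtopology (gtop G) U)
          (subtopology (subtopology (gtop G) (unit_space G)) (src G ` U)) (src G)"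
      using homeomorphic_map_src_bisection[OF assms B(1)] openin_unit_space[OF assms]
      by (intro exI[of _ B])
        (simp add: openin_open_subtopology subtopology_subtopology inf.absorb2)
  qed
  then show ?thesis
    using continuous_map_inv continuous_map_mult openin_unit_space assms by (simp add: etale_def)
qed

lemma openin_inv_image:
  assumes "continuous_map (gtop G) (gtop G) (ginv G)" "openin (gtop G) U"
  shows "openin (gtop G) (ginv G ` U)"
  using openin_continuous_map_preimage[OF assms] inv_image_eq_preimage[OF openin_subset[OF assms(2)]]
  by simp

text \<open>The source and range maps are open and continuous.  To see that \<open>UV\<close> is open near \<open>k = gh\<close>, use
  that \<open>(x, y) \<mapsto> x\<inverse>y\<close> is continuous at \<open>(g, k)\<close>: there are neighbourhoods \<open>M'\<close> of \<open>g\<close> in \<open>U\<close> and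
  \<open>N\<close> of \<open>k\<close> such that the quotients defined on \<open>M' \<times> N\<close> lie in \<open>V\<close>.  Since the range map is open, every point of \<open>N\<close> near
  \<open>k\<close> has the same range as some \<open>y \<in> M'\<close>, and left division by \<open>y\<close> exhibits it as an element of \<open>UV\<close>.\<close>

lemma open_operations_if_etale:
  assumes "etale G" shows "open_operations"
proof -
  let ?T = "gtop G"
  have inv: "continuous_map ?T ?T (ginv G)"
    and mult: "continuous_map (subtopology (prod_topology ?T ?T) (composable G)) ?T
       (\<lambda>(g, h). gmult G g h)"
    and unit: "openin ?T (unit_space G)"
    and loc: "local_homeomorphism ?T (subtopology ?T (unit_space G)) (src G)"
    using assms by (auto simp: etale_def)
  have loc': "\<exists>U. openin ?T U \<and> g \<in> U \<and> openin ?T (src G ` U) \<and>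
      homeomorphic_map (subtopology ?T U) (subtopology ?T (src G ` U)) (src G)"
    if "g \<in> arrows G" for g
  proof -
    from loc that obtain U where U: "openin ?T U" "g \<in> U"
      "openin (subtopology ?T (unit_space G)) (src G ` U)"
      "homeomorphic_map (subtopology ?T U)
         (subtopology (subtopology ?T (unit_space G)) (src G ` U)) (src G)"
      unfolding local_homeomorphism_def by blast
    then have "src G ` U \<subseteq> unit_space G" "openin ?T (src G ` U)"
      using unit by (auto simp: openin_open_subtopology)
    then show ?thesis using U by (auto simp: subtopology_subtopology inf.absorb2)
  qed
  have src_cont: "continuous_map ?T ?T (src G)"
    unfolding continuous_map_def
  proof (intro conjI allI impI)
    show "src G \<in> arrows G \<rightarrow> arrows G" by (auto simp: src_closed)
    fix W assume W: "openin ?T W"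
    show "openin ?T {g \<in> arrows G. src G g \<in> W}"
    proof (subst openin_subopen, intro ballI)
      fix g assume g: "g \<in> {g \<in> arrows G. src G g \<in> W}"
      then obtain U where U: "openin ?T U" "g \<in> U"
        "homeomorphic_map (subtopology ?T U) (subtopology ?T (src G ` U)) (src G)"
        using loc' by blast
      then have "continuous_map (subtopology ?T U) ?T (src G)"
        using homeomorphic_imp_continuous_map continuous_map_in_subtopology by blast
      then have "openin (subtopology ?T U) {x \<in> topspace (subtopology ?T U). src G x \<in> W}"
        using W openin_continuous_map_preimage by blast
      moreover have "{x \<in> topspace (subtopology ?T U). src G x \<in> W} = {x \<in> U. src G x \<in> W}"
        using openin_subset[OF U(1)] by auto
      ultimately have "openin ?T {x \<in> U. src G x \<in> W}"
        using U(1) by (simp add: openin_open_subtopology)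
      then show "\<exists>V. openin ?T V \<and> g \<in> V \<and> V \<subseteq> {g \<in> arrows G. src G g \<in> W}"
        using g U openin_subset[OF U(1)] by (intro exI[of _ "{x \<in> U. src G x \<in> W}"]) auto
    qed
  qed
  have src_open: "openin ?T (src G ` U)" if U: "openin ?T U" for U
  proof (subst openin_subopen, intro ballI)
    fix k assume "k \<in> src G ` U"
    then obtain g where g: "g \<in> U" "k = src G g" by blast
    then obtain V where V: "openin ?T V" "g \<in> V" "openin ?T (src G ` V)"
        "homeomorphic_map (subtopology ?T V) (subtopology ?T (src G ` V)) (src G)"
      using loc' openin_subset[OF U] by blast
    have "openin (subtopology ?T V) (U \<inter> V)"
      using U V(1) by (simp add: openin_open_subtopology openin_Int)
    then have "openin (subtopology ?T (src G ` V)) (src G ` (U \<inter> V))"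
      using homeomorphic_imp_open_map[OF V(4)] by (simp add: open_map_def)
    then have "openin ?T (src G ` (U \<inter> V))" using V(3) openin_trans_full by blast
    then show "\<exists>W. openin ?T W \<and> k \<in> W \<and> W \<subseteq> src G ` U" using g V by blast
  qed
  have rng_eq: "rng G g = src G (ginv G g)" if "g \<in> arrows G" for g
    using that by (simp add: src_inv)
  have rng_cont: "continuous_map ?T ?T (rng G)"
    using continuous_map_eq[OF continuous_map_compose[OF inv src_cont], of "rng G"] rng_eq by simp
  have rng_open: "openin ?T (rng G ` U)" if U: "openin ?T U" for U
  proof -
    have "rng G ` U = src G ` (ginv G ` U)"
      using rng_eq openin_subset[OF U] by (force simp: image_image)
    then show ?thesis using src_open openin_inv_image[OF inv U] by simp
  qed
  have "openin ?T (set_prod G U V)" if U: "openin ?T U" and V: "openin ?T V" for U V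
  proof (subst openin_subopen, intro ballI)
    fix k assume "k \<in> set_prod G U V"
    then obtain g h where gh: "g \<in> U" "h \<in> V" "(g, h) \<in> composable G" "k = gmult G g h"
      using set_prodE openin_subset[OF U] openin_subset[OF V] by blast
    have ka: "g \<in> arrows G" "k \<in> arrows G" "rng G g = rng G k"
      using gh mult_closed by (auto simp: composable_def rng_mult)
    define Q where "Q = {p \<in> composable G. (\<lambda>(g, h). gmult G g h) p \<in> V}"
    have "openin (subtopology (prod_topology ?T ?T) (composable G)) Q"
      using openin_continuous_map_preimage[OF mult V] unfolding Q_def
      by (rule back_subst) (auto simp: composable_def)
    then obtain Q' where Q': "openin (prod_topology ?T ?T) Q'" "Q = Q' \<inter> composable G"
      by (auto simp: openin_subtopology)
    have "(ginv G g, k) \<in> Q"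
      unfolding Q_def using left_quotient[OF ka] inv_mult_cancel[OF gh(3)] gh by simp
    then have "(ginv G g, k) \<in> Q'" using Q'(2) by simp
    then obtain M N where MN: "openin ?T M" "openin ?T N" "ginv G g \<in> M" "k \<in> N" "M \<times> N \<subseteq> Q'"
      using Q'(1)[unfolded openin_prod_topology_alt, THEN spec, THEN spec, THEN mp] by metis
    \<comment> \<open>The quotient map was applied to \<open>ginv G g\<close>, so its first neighbourhood \<open>M\<close> consists of inverses.\<close>
    define M' where "M' = U \<inter> ginv G ` M"
    have M': "openin ?T M'" "g \<in> M'"
      using U gh MN openin_inv_image[OF inv MN(1)] inv_image_iff[OF openin_subset[OF MN(1)] ka(1)]
      by (auto simp: M'_def)
    define W where "W = N \<inter> {x \<in> arrows G. rng G x \<in> rng G ` M'}"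
    have "openin ?T W"
      unfolding W_def using MN(2) openin_continuous_map_preimage[OF rng_cont rng_open[OF M'(1)]]
      by blast
    moreover have "k \<in> W" unfolding W_def using MN ka M' by (auto intro: rev_image_eqI)
    moreover have "W \<subseteq> set_prod G U V"
    proof
      fix x assume "x \<in> W"
      then obtain y where y: "x \<in> N" "x \<in> arrows G" "y \<in> M'" "rng G x = rng G y"
        by (auto simp: W_def)
      then have ya: "y \<in> arrows G" "y \<in> U" "ginv G y \<in> M"
        using openin_subset[OF M'(1)] inv_image_iff[OF openin_subset[OF MN(1)]]
        by (auto simp: M'_def)
      note q = left_quotient[OF ya(1) y(2) y(4)[symmetric]]
      have "(ginv G y, x) \<in> Q" using ya y MN(5) q(1) Q'(2) by auto
      then have "gmult G (ginv G y) x \<in> V" by (simp add: Q_def)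
      then show "x \<in> set_prod G U V"
        using set_prodI[of y U "gmult G (ginv G y) x" V] q ya by (simp add: composable_def)
    qed
    ultimately show "\<exists>W. openin ?T W \<and> k \<in> W \<and> W \<subseteq> set_prod G U V" by blast
  qed
  moreover have "g \<in> \<Union> (open_bisections G)" if g: "g \<in> arrows G" for g
  proof -
    obtain U where U: "openin ?T U" "g \<in> U"
        "homeomorphic_map (subtopology ?T U) (subtopology ?T (src G ` U)) (src G)"
      using loc' g by blast
    obtain V where V: "openin ?T V" "ginv G g \<in> V"
        "homeomorphic_map (subtopology ?T V) (subtopology ?T (src G ` V)) (src G)"
      using loc' inv_closed[OF g] by blast
    have Ua: "U \<subseteq> arrows G" and Va: "V \<subseteq> arrows G" using U V openin_subset by auto
    have inj: "inj_on (src G) U" "inj_on (src G) V"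
      using homeomorphic_imp_injective_map[OF U(3)] homeomorphic_imp_injective_map[OF V(3)] Ua Va
      by (simp_all add: inf.absorb2)
    have "inj_on (rng G) (ginv G ` V)"
      using inj(2) Va by (auto simp: inj_on_def rng_inv subset_iff)
    then have "bisection G (U \<inter> ginv G ` V)"
      using inj(1) Ua unfolding bisection_iff by (meson inf_le1 inf_le2 inj_on_subset order_trans)
    moreover have "openin ?T (U \<inter> ginv G ` V)" using U(1) openin_inv_image[OF inv V(1)] by blast
    moreover have "g \<in> U \<inter> ginv G ` V" using U V inv_image_iff[OF Va g] by blast
    ultimately show ?thesis by (auto simp: open_bisections_def)
  qed
  ultimately show ?thesis
    unfolding open_operations_def using openin_inv_image[OF inv] by blast
qed

end

section \<open>Bumpy semigroups live on locally compact etale groupoids\<close>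

lemma level_subset_dom: "level W a \<subseteq> dom a"
  by (auto simp: level_def)

lemma dom_pmult: "dom (pmult G Y a b) = set_prod G (dom a) (dom b)"
  by (auto simp: pmult_def dom_def)

context groupoid
begin

lemma open_operations_if_bumpy_semigroup:
  assumes "bumpy_semigroup G Y S" shows "open_operations"
proof -
  have S: "\<And>a. a \<in> S \<Longrightarrow> dom a \<in> open_bisections G"
    and S_mult: "\<And>a b. \<lbrakk>a \<in> S; b \<in> S\<rbrakk> \<Longrightarrow> pmult G Y a b \<in> S"
    and ury: "urysohn G Y S" and invol: "involutive G Y S"
    using assms by (auto simp: bumpy_semigroup_def bumpy_def partial_functions_def)
  have basis: "\<exists>a\<in>S. dom a \<subseteq> U \<and> g \<in> gtop G interior_of (level (Units Y) a)"
    if "openin (gtop G) U" "g \<in> U" for U g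
    using ury that by (auto simp: urysohn_def)
  have in_dom: "g \<in> dom a" if "g \<in> gtop G interior_of (level (Units Y) a)" for g a
    using subsetD[OF level_subset_dom subsetD[OF interior_of_subset that]] .
  have "openin (gtop G) (ginv G ` U)" if U: "openin (gtop G) U" for U
  proof (subst openin_subopen, intro ballI)
    fix k assume "k \<in> ginv G ` U"
    then obtain g where g: "g \<in> U" "k = ginv G g" by blast
    obtain a where a: "a \<in> S" "dom a \<subseteq> U" "g \<in> gtop G interior_of (level (Units Y) a)"
      using basis[OF U g(1)] by blast
    then obtain b where b: "ginv G g \<in> gtop G interior_of
        {h \<in> arrows G. \<exists>y\<in>Units Y. b h = Some y \<and> a (ginv G h) = Some (inv\<^bsub>Y\<^esub> y)}"
        (is "_ \<in> _ interior_of ?N")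
      using invol unfolding involutive_def by blast
    have "?N \<subseteq> ginv G ` U"
      using a(2) inv_image_iff[OF openin_subset[OF U]] by blast
    then show "\<exists>W. openin (gtop G) W \<and> k \<in> W \<and> W \<subseteq> ginv G ` U"
      using b g(2) interior_of_subset[of "gtop G" ?N] by (intro exI[of _ "gtop G interior_of ?N"]) auto
  qed
  moreover have "openin (gtop G) (set_prod G U V)"
    if U: "openin (gtop G) U" and V: "openin (gtop G) V" for U V
  proof (subst openin_subopen, intro ballI)
    fix k assume "k \<in> set_prod G U V"
    then obtain g h where gh: "g \<in> U" "h \<in> V" "src G g = rng G h" "k = gmult G g h"
      by (auto simp: set_prod_def)
    obtain a b where ab: "a \<in> S" "dom a \<subseteq> U" "g \<in> dom a" "b \<in> S" "dom b \<subseteq> V" "h \<in> dom b"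
      using basis[OF U gh(1)] basis[OF V gh(2)] in_dom by metis
    have "openin (gtop G) (set_prod G (dom a) (dom b))"
      using S[OF S_mult[OF ab(1,4)]] by (simp add: dom_pmult open_bisections_def)
    moreover have "k \<in> set_prod G (dom a) (dom b)" using gh ab by (auto intro: set_prodI)
    moreover have "set_prod G (dom a) (dom b) \<subseteq> set_prod G U V"
      using ab(2,5) unfolding set_prod_def by blast
    ultimately show "\<exists>W. openin (gtop G) W \<and> k \<in> W \<and> W \<subseteq> set_prod G U V" by blast
  qed
  moreover have "g \<in> \<Union> (open_bisections G)" if "g \<in> arrows G" for g
    using basis[OF openin_topspace that] S in_dom by blast
  ultimately show ?thesis unfolding open_operations_def by blast
qed

text \<open>If \<open>b\<close> inverts \<open>a\<close> near the unit \<open>u\<close>, then \<open>ab\<close> is \<open>1\<close> at all units near \<open>u\<close>.  The compact set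
  \<open>[1](ab)\<close> need not consist of units, but applying the source map pushes it into the unit space and
  fixes those units.\<close>

lemma locally_compact_unit_space_if_bumpy_semigroup:
  assumes "monoid Y" "bumpy_semigroup G Y S"
  shows "locally_compact_space (subtopology (gtop G) (unit_space G))"
  unfolding locally_compact_space_def
proof
  fix u assume "u \<in> topspace (subtopology (gtop G) (unit_space G))"
  then have u: "u \<in> unit_space G" "u \<in> arrows G" by auto
  have oo: "open_operations" using open_operations_if_bumpy_semigroup assms(2) .
  have S: "\<And>a. a \<in> S \<Longrightarrow> dom a \<in> open_bisections G"
    and S_mult: "\<And>a b. \<lbrakk>a \<in> S; b \<in> S\<rbrakk> \<Longrightarrow> pmult G Y a b \<in> S"
    and proper: "one_proper G Y S" and ury: "urysohn G Y S" and invol: "involutive G Y S"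
    using assms by (auto simp: bumpy_semigroup_def bumpy_def partial_functions_def)
  obtain a where a: "a \<in> S" "u \<in> gtop G interior_of (level (Units Y) a)"
    using ury u openin_topspace unfolding urysohn_def by blast
  let ?N = "\<lambda>b. {h \<in> arrows G. \<exists>y\<in>Units Y. b h = Some y \<and> a (ginv G h) = Some (inv\<^bsub>Y\<^esub> y)}"
  obtain b where b: "b \<in> S" "ginv G u \<in> gtop G interior_of (?N b)"
    using invol a unfolding involutive_def by blast
  define W where "W = gtop G interior_of (?N b) \<inter> unit_space G"
  define K where "K = src G ` level {\<one>\<^bsub>Y\<^esub>} (pmult G Y a b)"
  have "compactin (gtop G) (level {\<one>\<^bsub>Y\<^esub>} (pmult G Y a b))"
    using proper S_mult[OF a(1) b(1)] by (simp add: one_proper_def)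
  then have K: "compactin (gtop G) K"
    unfolding K_def using image_compactin continuous_map_src[OF oo] by blast
  have dom_arrows: "dom a \<subseteq> arrows G" "dom b \<subseteq> arrows G"
    "dom (pmult G Y a b) \<subseteq> arrows G"
    using S a(1) b(1) S_mult open_bisection_arrows by blast+
  have K_unit: "K \<subseteq> unit_space G"
    using order_trans[OF level_subset_dom dom_arrows(3)] src_in_unit_space
    unfolding K_def by (intro image_subsetI) blast
  have "W \<subseteq> K"
  proof
    fix h assume h: "h \<in> W"
    then have hu: "h \<in> unit_space G" by (simp add: W_def)
    have "h \<in> ?N b" using h interior_of_subset[of "gtop G" "?N b"] by (auto simp: W_def)
    then obtain y where y: "y \<in> Units Y" "b h = Some y" "a h = Some (inv\<^bsub>Y\<^esub> y)"
      using inv_unit[OF hu] by auto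
    have "pmult G Y a b (gmult G h h) = Some (inv\<^bsub>Y\<^esub> y \<otimes>\<^bsub>Y\<^esub> y)"
      using dom_arrows S[OF a(1)] y src_unit[OF hu] rng_unit[OF hu]
      by (intro pmult_eq) (auto simp: open_bisections_def)
    then have "h \<in> level {\<one>\<^bsub>Y\<^esub>} (pmult G Y a b)"
      using mult_unit_self[OF hu] monoid.Units_l_inv[OF assms(1) y(1)] by (simp add: level_def)
    then show "h \<in> K" unfolding K_def using src_unit[OF hu] by force
  qed
  moreover have "openin (subtopology (gtop G) (unit_space G)) W"
    unfolding W_def by (simp add: openin_subtopology_Int)
  moreover have "u \<in> W" using b u inv_unit by (simp add: W_def)
  moreover have "compactin (subtopology (gtop G) (unit_space G)) K"
    using K K_unit by (simp add: compactin_subtopology)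
  ultimately show "\<exists>W K. openin (subtopology (gtop G) (unit_space G)) W \<and>
      compactin (subtopology (gtop G) (unit_space G)) K \<and> u \<in> W \<and> W \<subseteq> K" by blast
qed

lemma locally_compact_if_unit_space:
  assumes "open_operations" "Hausdorff_space (subtopology (gtop G) (unit_space G))"
    "locally_compact_space (subtopology (gtop G) (unit_space G))"
  shows "locally_compact G"
  unfolding locally_compact_def neighbourhood_base_of
proof (intro allI impI)
  let ?X = "subtopology (gtop G) (unit_space G)"
  fix W g assume Wg: "openin (gtop G) W \<and> g \<in> W"
  then obtain B where B: "B \<in> open_bisections G" "g \<in> B" "B \<subseteq> W"
    using open_bisection_basis[OF assms(1)] by blast
  have Bo: "openin (gtop G) B" and Ba: "B \<subseteq> arrows G"
    using B open_bisection_arrows by (auto simp: open_bisections_def)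
  have "src G ` B \<subseteq> unit_space G" using Ba src_in_unit_space by blast
  then have "openin ?X (src G ` B)"
    using open_map_src[OF assms(1)] Bo openin_unit_space[OF assms(1)]
    by (simp add: open_map_def openin_open_subtopology)
  moreover have "src G g \<in> src G ` B" using B by simp
  moreover have "neighbourhood_base_of (compactin ?X) ?X"
    using assms(2,3) locally_compact_space_neighbourhood_base by blast
  ultimately obtain V K where VK: "openin ?X V" "compactin ?X K" "src G g \<in> V" "V \<subseteq> K" "K \<subseteq> src G ` B"
    unfolding neighbourhood_base_of by metis
  let ?V = "{x \<in> B. src G x \<in> V}" and ?K = "{x \<in> B. src G x \<in> K}"
  have "openin (gtop G) V" using VK(1) openin_unit_space[OF assms(1)] openin_trans_full by blast
  then have "openin (gtop G) ?V"
    using openin_continuous_map_preimage_gen[OF continuous_map_src[OF assms(1)] Bo] by blast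
  moreover have "src G ` ?K = K" using VK(5) by blast
  then have "compactin (subtopology (gtop G) (src G ` B)) (src G ` ?K)"
    using VK(2,5) by (simp add: compactin_subtopology)
  then have "compactin (subtopology (gtop G) B) ?K"
    using homeomorphic_map_compactness[OF homeomorphic_map_src_bisection[OF assms(1) B(1)], of ?K] Ba
    by auto
  then have "compactin (gtop G) ?K" by (simp add: compactin_subtopology)
  moreover have "g \<in> ?V" "?V \<subseteq> ?K" "?K \<subseteq> W" using VK B by auto
  ultimately show "\<exists>V K. openin (gtop G) V \<and> compactin (gtop G) K \<and> g \<in> V \<and> V \<subseteq> K \<and> K \<subseteq> W"
    by blast
qed

end

section \<open>The functions vanishing at infinity on open bisections\<close>

lemma closedin_preimage_subtopology:
  assumes "U \<subseteq> topspace X" "continuous_map (subtopology X U) euclidean f" "closed C"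
  shows "closedin (subtopology X U) {x \<in> U. f x \<in> C}"
proof -
  have "topspace (subtopology X U) = U" using assms(1) by auto
  then show ?thesis using closedin_continuous_map_preimage[OF assms(2)] assms(3) by simp
qed

text \<open>Complete regularity only gives a function with the right value at the single point \<open>x\<close>;
  doubling and truncating it gives the value \<open>1\<close> on a whole neighbourhood, which is what an
  interior point of a level set needs.\<close>

lemma bump_function:
  assumes "Hausdorff_space X" "locally_compact_space X" "x \<in> topspace X"
  obtains f :: "'a \<Rightarrow> real" where "continuous_map X euclideanreal f"
    "\<And>y. y \<in> topspace X \<Longrightarrow> 0 \<le> f y \<and> f y \<le> 1"
    "x \<in> X interior_of {y \<in> topspace X. f y = 1}"
    "\<And>\<epsilon>. \<epsilon> > 0 \<Longrightarrow> compactin X {y \<in> topspace X. f y \<ge> \<epsilon>}"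
proof -
  obtain V K where VK: "openin X V" "compactin X K" "x \<in> V" "V \<subseteq> K"
    using assms(2,3) by (auto simp: locally_compact_space_def)
  have "completely_regular_space X"
    using assms locally_compact_regular_imp_completely_regular_space by blast
  moreover have "closedin X (topspace X - V)" "x \<in> topspace X - (topspace X - V)"
    using VK assms by auto
  ultimately obtain q :: "'a \<Rightarrow> real" where q: "continuous_map X (top_of_set {0..1}) q"
    "q x = 0" "q ` (topspace X - V) \<subseteq> {1}"
    unfolding completely_regular_space_def by blast
  have qc: "continuous_map X euclideanreal q" and q01: "\<And>y. y \<in> topspace X \<Longrightarrow> 0 \<le> q y \<and> q y \<le> 1"
    using q(1) by (auto simp: continuous_map_in_subtopology Pi_iff)
  \<comment> \<open>\<open>q\<close> is \<open>0\<close> at \<open>x\<close> and \<open>1\<close> off \<open>V\<close>, so \<open>f\<close> is \<open>1\<close> where \<open>q < 1/2\<close> and \<open>0\<close> off \<open>V\<close>.\<close>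
  define f where "f y = min 1 (2 * (1 - q y))" for y
  have fc: "continuous_map X euclideanreal f"
    unfolding f_def using qc by (intro continuous_intros continuous_map_real_min) auto
  show thesis
  proof (rule that)
    show "continuous_map X euclideanreal f" by (rule fc)
    show "0 \<le> f y \<and> f y \<le> 1" if "y \<in> topspace X" for y
      using q01[OF that] by (auto simp: f_def)
    have "openin X {y \<in> topspace X. q y \<in> {..<1/2}}"
      using openin_continuous_map_preimage[OF qc] by (simp del: lessThan_iff)
    moreover have "{y \<in> topspace X. q y \<in> {..<1/2}} \<subseteq> {y \<in> topspace X. f y = 1}"
      by (auto simp: f_def)
    ultimately show "x \<in> X interior_of {y \<in> topspace X. f y = 1}"
      using interior_of_maximal q(2) assms(3) by fastforce
    show "compactin X {y \<in> topspace X. f y \<ge> \<epsilon>}" if "\<epsilon> > 0" for \<epsilon>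
    proof (rule closed_compactin[OF VK(2)])
      show "{y \<in> topspace X. \<epsilon> \<le> f y} \<subseteq> K"
        using q(3) VK(4) that by (fastforce simp: f_def)
      have "closedin X {y \<in> topspace X. f y \<in> {\<epsilon>..}}"
        using closedin_continuous_map_preimage[OF fc] by (simp del: atLeast_iff)
      then show "closedin X {y \<in> topspace X. \<epsilon> \<le> f y}" by simp
    qed
  qed
qed

text \<open>Inverses in the disc must not have modulus greater than \<open>1\<close>, which leaves the unit circle.\<close>

lemma Units_punctured_disc: "Units punctured_disc = {z. norm z = 1}"
proof -
  have "norm x = 1" if "norm x \<le> 1" "norm y \<le> 1" "x * y = 1" for x y :: complex
  proof -
    have "norm x * norm y = 1" using that(3) by (metis norm_mult norm_one)
    moreover have "norm x * norm y \<le> norm x * 1" using that(2) by (intro mult_left_mono) auto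
    ultimately show ?thesis using that(1) by linarith
  qed
  moreover have "cnj x * x = 1 \<and> x * cnj x = 1" if "norm x = 1" for x
    using that complex_norm_square[of x] by (simp add: mult.commute)
  ultimately show ?thesis
    unfolding Units_def punctured_disc_def by (auto intro!: bexI[of _ "cnj _"])
qed

lemma inv_punctured_disc:
  assumes "norm z = 1" shows "inv\<^bsub>punctured_disc\<^esub> z = cnj z"
proof -
  have "z * cnj z = 1" using assms complex_norm_square[of z] by simp
  moreover have "z \<noteq> 0" using assms by auto
  ultimately show ?thesis
    using assms monoid.inv_unique'[OF monoid_punctured_disc, of z "cnj z"]
    by (auto simp: punctured_disc_def mult.commute)
qed

context groupoid
begin

lemma Hausdorff_space_bisection:
  assumes "open_operations" "Hausdorff_space (subtopology (gtop G) (unit_space G))"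
    "B \<in> open_bisections G"
  shows "Hausdorff_space (subtopology (gtop G) B)"
proof (rule Hausdorff_space_injective_preimage[OF assms(2)])
  have B: "B \<subseteq> arrows G" "inj_on (src G) B"
    using assms(3) by (auto simp: open_bisections_def bisection_iff)
  show "continuous_map (subtopology (gtop G) B) (subtopology (gtop G) (unit_space G)) (src G)"
    using continuous_map_src[OF assms(1)] src_in_unit_space
    by (simp add: continuous_map_in_subtopology continuous_map_from_subtopology)
  show "inj_on (src G) (topspace (subtopology (gtop G) B))"
    using B by (auto simp: inj_on_def)
qed

lemma C0_I:
  assumes "dom a = U" "\<And>g. g \<in> U \<Longrightarrow> norm (the (a g)) \<le> 1 \<and> the (a g) \<noteq> 0"
    and "continuous_map (subtopology (gtop G) U) euclidean (\<lambda>g. the (a g))"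
    and "\<And>\<epsilon>. \<epsilon> > 0 \<Longrightarrow> compactin (gtop G) {g \<in> U. norm (the (a g)) \<ge> \<epsilon>}"
  shows "a \<in> C0 G U"
proof -
  have "ran a \<subseteq> carrier punctured_disc"
  proof
    fix z assume "z \<in> ran a"
    then obtain g where "a g = Some z" by (auto simp: ran_def)
    then show "z \<in> carrier punctured_disc"
      using assms(1) assms(2)[of g] by (auto simp: punctured_disc_def domI)
  qed
  then show ?thesis using assms by (auto simp: C0_def)
qed

lemma C0_D:
  assumes "a \<in> C0 G U" "g \<in> U"
  shows "a g = Some (the (a g))" "norm (the (a g)) \<le> 1" "the (a g) \<noteq> 0"
proof -
  from assms obtain z where z: "a g = Some z" "z \<in> carrier punctured_disc"
    by (auto simp: C0_def ran_def)
  then show "a g = Some (the (a g))" "norm (the (a g)) \<le> 1" "the (a g) \<noteq> 0"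
    by (auto simp: punctured_disc_def)
qed

lemma openin_C0_preimage:
  assumes "a \<in> C0 G U" "openin (gtop G) U" "open W"
  shows "openin (gtop G) {g \<in> U. the (a g) \<in> W}"
proof -
  have "continuous_map (subtopology (gtop G) U) euclidean (\<lambda>g. the (a g))"
    using assms(1) by (simp add: C0_def)
  then have "openin (subtopology (gtop G) U) {g \<in> topspace (subtopology (gtop G) U). the (a g) \<in> W}"
    using openin_continuous_map_preimage assms(3) by fastforce
  moreover have "{g \<in> topspace (subtopology (gtop G) U). the (a g) \<in> W} = {g \<in> U. the (a g) \<in> W}"
    using openin_subset[OF assms(2)] by auto
  ultimately show ?thesis using assms(2) by (simp add: openin_open_subtopology)
qed

text \<open>The level set is closed in \<open>U\<close> and contained in the compact set where \<open>|a| \<ge> 1\<close>.  All compactness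
  arguments run inside the domain \<open>U\<close>, since a set closed in \<open>U\<close> may fail to be closed in \<open>G\<close>.\<close>

lemma one_proper_C0: "one_proper G punctured_disc (\<Union>U\<in>open_bisections G. C0 G U)"
  unfolding one_proper_def
proof (intro ballI, elim UN_E)
  fix a U assume U: "U \<in> open_bisections G" and a: "a \<in> C0 G U"
  have "closedin (subtopology (gtop G) U) {g \<in> U. the (a g) \<in> {1}}"
    using a open_bisection_arrows[OF U] by (intro closedin_preimage_subtopology) (auto simp: C0_def)
  moreover have "compactin (subtopology (gtop G) U) {g \<in> U. norm (the (a g)) \<ge> 1}"
    using a by (simp add: C0_def compactin_subtopology)
  ultimately have "compactin (subtopology (gtop G) U) {g \<in> U. the (a g) \<in> {1}}"
    by (rule closed_compactin[rotated 2]) auto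
  moreover have "level {\<one>\<^bsub>punctured_disc\<^esub>} a = {g \<in> U. the (a g) \<in> {1}}"
    using a C0_D(1)[OF a] by (auto simp: level_def punctured_disc_def C0_def)
  ultimately show "compactin (gtop G) (level {\<one>\<^bsub>punctured_disc\<^esub>} a)"
    by (simp add: compactin_subtopology)
qed

text \<open>Restricting a bump function on a bisection to the set where it is positive produces a nowhere
  vanishing function.  It vanishes at infinity on this smaller domain, because for \<open>\<epsilon> > 0\<close> the set where
  it is at least \<open>\<epsilon>\<close> is the same for both domains.\<close>

lemma urysohn_C0:
  assumes "open_operations" "Hausdorff_space (subtopology (gtop G) (unit_space G))"
    "locally_compact G"
  shows "urysohn G punctured_disc (\<Union>U\<in>open_bisections G. C0 G U)"
  unfolding urysohn_def
proof (intro conjI allI impI)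
  have "{} \<in> open_bisections G" by (simp add: open_bisections_def bisection_iff)
  moreover have "Map.empty \<in> C0 G {}" by (rule C0_I) auto
  ultimately show "Map.empty \<in> (\<Union>U\<in>open_bisections G. C0 G U)" by blast
next
  fix W g assume Wg: "openin (gtop G) W \<and> g \<in> W"
  then obtain B where B: "B \<in> open_bisections G" "g \<in> B" "B \<subseteq> W"
    using open_bisection_basis[OF assms(1)] by blast
  have Bo: "openin (gtop G) B" and Ba: "B \<subseteq> arrows G"
    using B open_bisection_arrows by (auto simp: open_bisections_def)
  let ?X = "subtopology (gtop G) B"
  have top: "topspace ?X = B" using Ba by auto
  have "locally_compact_space ?X"
    unfolding locally_compact_space_def
  proof
    fix x assume "x \<in> topspace ?X"
    then obtain V K where "openin (gtop G) V" "compactin (gtop G) K" "x \<in> V" "V \<subseteq> K" "K \<subseteq> B"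
      using assms(3) Bo unfolding top locally_compact_def neighbourhood_base_of by metis
    then show "\<exists>V K. openin ?X V \<and> compactin ?X K \<and> x \<in> V \<and> V \<subseteq> K"
      using Bo by (intro exI[of _ V] exI[of _ K])
        (auto simp: openin_open_subtopology compactin_subtopology)
  qed
  then obtain f :: "'g \<Rightarrow> real" where f: "continuous_map ?X euclideanreal f"
    "\<And>y. y \<in> B \<Longrightarrow> 0 \<le> f y \<and> f y \<le> 1" "g \<in> ?X interior_of {y \<in> B. f y = 1}"
    "\<And>\<epsilon>. \<epsilon> > 0 \<Longrightarrow> compactin ?X {y \<in> B. f y \<ge> \<epsilon>}"
    using bump_function[OF Hausdorff_space_bisection[OF assms(1,2) B(1)], of g] B(2)
    unfolding top by blast
  define U where "U = {y \<in> B. f y > 0}"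
  define a where "a y = (if y \<in> U then Some (complex_of_real (f y)) else None)" for y
  have dom_a: "dom a = U" by (auto simp: a_def dom_def)
  have "openin ?X {y \<in> topspace ?X. f y \<in> {0<..}}"
    using openin_continuous_map_preimage[OF f(1)] by (simp del: greaterThan_iff)
  then have Uo: "openin (gtop G) U"
    using Bo unfolding top by (simp add: U_def openin_open_subtopology)
  have U: "U \<in> open_bisections G"
    using open_bisection_restrict[OF B(1) Uo] by (simp add: U_def inf.absorb1 Int_def cong: conj_cong)
  have "a \<in> C0 G U"
  proof (rule C0_I)
    show "dom a = U" by (rule dom_a)
    show "norm (the (a y)) \<le> 1 \<and> the (a y) \<noteq> 0" if "y \<in> U" for y
      using that f(2)[of y] by (auto simp: a_def U_def)
    have "continuous_map (subtopology (gtop G) U) euclideanreal f"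
      using continuous_map_from_subtopology_mono[OF f(1)] by (simp add: U_def)
    then have "continuous_map (subtopology (gtop G) U) euclidean (complex_of_real \<circ> f)"
      by (rule continuous_map_compose) (auto intro!: continuous_intros simp: continuous_map_iff_continuous2)
    then show "continuous_map (subtopology (gtop G) U) euclidean (\<lambda>g. the (a g))"
      by (rule continuous_map_eq) (auto simp: a_def)
    show "compactin (gtop G) {y \<in> U. norm (the (a y)) \<ge> \<epsilon>}" if "\<epsilon> > 0" for \<epsilon>
    proof -
      have "{y \<in> U. norm (the (a y)) \<ge> \<epsilon>} = {y \<in> B. f y \<ge> \<epsilon>}"
        using that by (auto simp: U_def a_def)
      then show ?thesis using f(4)[OF that] by (simp add: compactin_subtopology)
    qed
  qed
  moreover have "g \<in> gtop G interior_of (level (Units punctured_disc) a)"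
  proof -
    let ?I = "?X interior_of {y \<in> B. f y = 1}"
    have "openin (gtop G) ?I" using openin_trans_full[OF openin_interior_of Bo] .
    moreover have "?I \<subseteq> level (Units punctured_disc) a"
      using interior_of_subset[of ?X "{y \<in> B. f y = 1}"]
      by (auto simp: level_def Units_punctured_disc a_def U_def)
    ultimately show ?thesis using f(3) interior_of_maximal by blast
  qed
  moreover have "dom a \<subseteq> W" using dom_a B(3) by (auto simp: U_def)
  ultimately show "\<exists>a\<in>\<Union>U\<in>open_bisections G. C0 G U. dom a \<subseteq> W \<and>
      g \<in> gtop G interior_of (level (Units punctured_disc) a)"
    using U by blast
qed

text \<open>Conjugation replaces the pointwise inverse: it agrees with the inverse on the unit circle, and
  unlike the inverse it keeps all other values inside the disc.\<close>

lemma C0_adjoint: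
  assumes "open_operations" "U \<in> open_bisections G" "a \<in> C0 G U"
  shows "(\<lambda>h. if h \<in> ginv G ` U then Some (cnj (the (a (ginv G h)))) else None) \<in> C0 G (ginv G ` U)"
    (is "?b \<in> _")
proof (rule C0_I)
  have U: "U \<subseteq> arrows G" using open_bisection_arrows assms(2) .
  note ic = continuous_map_inv[OF assms(1)]
  have inv_U: "ginv G h \<in> U" if "h \<in> ginv G ` U" for h
    using that U by (auto simp: inv_inv subset_iff)
  show "dom ?b = ginv G ` U" by (auto simp: dom_def)
  show "norm (the (?b h)) \<le> 1 \<and> the (?b h) \<noteq> 0" if "h \<in> ginv G ` U" for h
    using that C0_D[OF assms(3) inv_U[OF that]] by simp
  have "continuous_map (subtopology (gtop G) (ginv G ` U)) (subtopology (gtop G) U) (ginv G)"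
    using ic inv_U by (auto simp: continuous_map_in_subtopology continuous_map_from_subtopology)
  then have "continuous_map (subtopology (gtop G) (ginv G ` U)) euclidean ((\<lambda>g. the (a g)) \<circ> ginv G)"
    using assms(3) by (auto simp: C0_def intro: continuous_map_compose)
  then have "continuous_map (subtopology (gtop G) (ginv G ` U)) euclidean
      (cnj \<circ> ((\<lambda>g. the (a g)) \<circ> ginv G))"
    by (rule continuous_map_compose) (auto intro!: continuous_intros simp: continuous_map_iff_continuous2)
  then show "continuous_map (subtopology (gtop G) (ginv G ` U)) euclidean (\<lambda>h. the (?b h))"
    by (rule continuous_map_eq) auto
  show "compactin (gtop G) {h \<in> ginv G ` U. norm (the (?b h)) \<ge> \<epsilon>}" if "\<epsilon> > 0" for \<epsilon>
  proof -
    have "norm (the (?b (ginv G g))) = norm (the (a g))" if "g \<in> U" for g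
      using that U by (simp add: inv_inv subset_iff)
    then have "{g \<in> U. norm (the (?b (ginv G g))) \<ge> \<epsilon>} = {g \<in> U. norm (the (a g)) \<ge> \<epsilon>}"
      by (intro Collect_cong conj_cong) simp_all
    moreover have "{h \<in> ginv G ` U. P h} = ginv G ` {g \<in> U. P (ginv G g)}" for P
      by blast
    ultimately have "{h \<in> ginv G ` U. norm (the (?b h)) \<ge> \<epsilon>} =
        ginv G ` {g \<in> U. norm (the (a g)) \<ge> \<epsilon>}"
      by (simp only:)
    then show ?thesis using assms(3) that image_compactin[OF _ ic] by (simp add: C0_def)
  qed
qed

lemma involutive_C0:
  assumes "open_operations"
  shows "involutive G punctured_disc (\<Union>U\<in>open_bisections G. C0 G U)"
  unfolding involutive_def
proof (intro ballI, elim UN_E)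
  fix a g U
  assume g: "g \<in> gtop G interior_of level (Units punctured_disc) a"
    and U: "U \<in> open_bisections G" and a: "a \<in> C0 G U"
  define b where "b = (\<lambda>h. if h \<in> ginv G ` U then Some (cnj (the (a (ginv G h)))) else None)"
  let ?I = "gtop G interior_of level (Units punctured_disc) a"
  let ?N = "{h \<in> arrows G. \<exists>y\<in>Units punctured_disc. b h = Some y \<and>
    a (ginv G h) = Some (inv\<^bsub>punctured_disc\<^esub> y)}"
  have "ginv G ` U \<in> open_bisections G"
    using U assms bisection_inv by (auto simp: open_bisections_def open_operations_def)
  then have bS: "b \<in> (\<Union>U\<in>open_bisections G. C0 G U)"
    using C0_adjoint[OF assms U a] unfolding b_def by blast
  have "ginv G ` ?I \<subseteq> ?N"
  proof (rule image_subsetI)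
    fix h assume "h \<in> ?I"
    then have "h \<in> level (Units punctured_disc) a"
      using interior_of_subset[of "gtop G"] by blast
    then obtain z where z: "norm z = 1" "a h = Some z" by (auto simp: level_def Units_punctured_disc)
    have hU: "h \<in> U" using z(2) a by (auto simp: C0_def)
    then have ha: "h \<in> arrows G" using open_bisection_arrows[OF U] by blast
    have "b (ginv G h) = Some (cnj z)" using hU z ha by (simp add: b_def inv_inv)
    then show "ginv G h \<in> ?N"
      using z ha by (simp add: inv_closed inv_inv Units_punctured_disc inv_punctured_disc)
  qed
  moreover have "openin (gtop G) (ginv G ` ?I)" using assms by (simp add: open_operations_def)
  ultimately have "ginv G ` ?I \<subseteq> gtop G interior_of ?N" by (rule interior_of_maximal)
  then show "\<exists>b\<in>\<Union>U\<in>open_bisections G. C0 G U. ginv G g \<in> gtop G interior_of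
      {h \<in> arrows G. \<exists>y\<in>Units punctured_disc. b h = Some y \<and>
        a (ginv G h) = Some (inv\<^bsub>punctured_disc\<^esub> y)}"
    using bS g by blast
qed

text \<open>A Hausdorff unit space makes the equation \<open>src g = rng h\<close> a closed condition, so the composable
  pairs in \<open>K \<times> L\<close> form a compact set.\<close>

lemma compactin_set_prod:
  assumes "open_operations" "Hausdorff_space (subtopology (gtop G) (unit_space G))"
    "compactin (gtop G) K" "compactin (gtop G) L"
  shows "compactin (gtop G) (set_prod G K L)"
proof -
  let ?T = "gtop G" let ?P = "prod_topology ?T ?T" let ?X = "subtopology ?T (unit_space G)"
  have KL: "K \<subseteq> arrows G" "L \<subseteq> arrows G" using assms compactin_subset_topspace by auto
  have s: "continuous_map ?T ?X (src G)"
    using continuous_map_src[OF assms(1)] src_in_unit_space by (simp add: continuous_map_in_subtopology)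
  have "continuous_map ?T ?X (src G \<circ> ginv G)"
    using continuous_map_compose[OF continuous_map_inv[OF assms(1)] s] .
  then have r: "continuous_map ?T ?X (rng G)"
    by (rule continuous_map_eq) (simp add: src_inv)
  have "closedin ?P {p \<in> topspace ?P. (src G \<circ> fst) p = (rng G \<circ> snd) p}"
    using closedin_continuous_maps_eq[OF assms(2) continuous_map_compose[OF continuous_map_fst s]
        continuous_map_compose[OF continuous_map_snd r]] .
  moreover have "{p \<in> topspace ?P. (src G \<circ> fst) p = (rng G \<circ> snd) p} = composable G"
    by (auto simp: composable_def)
  ultimately have "closedin ?P (composable G)" by simp
  moreover have "compactin ?P (K \<times> L)" using assms by (simp add: compactin_Times)
  ultimately have "compactin ?P (composable G \<inter> K \<times> L)" by (rule closed_Int_compactin)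
  then have "compactin (subtopology ?P (composable G)) (composable G \<inter> K \<times> L)"
    by (simp add: compactin_subtopology)
  then have "compactin ?T ((\<lambda>(g, h). gmult G g h) ` (composable G \<inter> K \<times> L))"
    using image_compactin continuous_map_mult[OF assms(1)] by blast
  moreover have "(\<lambda>(g, h). gmult G g h) ` (composable G \<inter> K \<times> L) = set_prod G K L"
    using KL by (force simp: set_prod_def composable_def subset_iff)
  ultimately show ?thesis by simp
qed

text \<open>Near \<open>k = gh\<close> the product \<open>ab\<close> takes values close to \<open>a(g)b(h)\<close> on the product of neighbourhoods
  of \<open>g\<close> and \<open>h\<close>, which is open; this replaces continuity of the factors \<open>g\<close> and \<open>h\<close> as functions of
  \<open>k\<close>.\<close>

lemma C0_pmult:
  assumes "open_operations" "Hausdorff_space (subtopology (gtop G) (unit_space G))"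
    "U \<in> open_bisections G" "V \<in> open_bisections G" "a \<in> C0 G U" "b \<in> C0 G V"
  shows "pmult G punctured_disc a b \<in> C0 G (set_prod G U V)"
proof (rule C0_I)
  let ?P = "set_prod G U V"
  define c where "c = pmult G punctured_disc a b"
  have dom: "dom a = U" "dom b = V" using assms(5,6) by (simp_all add: C0_def)
  have Uo: "openin (gtop G) U" "openin (gtop G) V" and bis: "bisection G U" "bisection G V"
    using assms(3,4) by (auto simp: open_bisections_def)
  have UV: "U \<subseteq> arrows G" "V \<subseteq> arrows G" using bis by (auto simp: bisection_def)
  have P: "?P \<subseteq> arrows G" using set_prod_subset_arrows UV by blast
  have c_mult: "the (c (gmult G g h)) = the (a g) * the (b h)"
    if "g \<in> U" "h \<in> V" "src G g = rng G h" for g h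
    using pmult_eq[of a b g "the (a g)" h "the (b h)" punctured_disc]
      C0_D(1)[OF assms(5) that(1)] C0_D(1)[OF assms(6) that(2)] that(3) dom UV bis(1)
    by (simp add: c_def punctured_disc_def)
  have split: "\<exists>g h. g \<in> U \<and> h \<in> V \<and> src G g = rng G h \<and> k = gmult G g h \<and>
      the (c k) = the (a g) * the (b h)" if "k \<in> ?P" for k
    using that c_mult unfolding set_prod_def by blast
  show "dom c = ?P" using dom by (simp add: c_def dom_pmult)
  show "norm (the (c k)) \<le> 1 \<and> the (c k) \<noteq> 0" if k: "k \<in> ?P" for k
  proof -
    obtain g h where "g \<in> U" "h \<in> V" "the (c k) = the (a g) * the (b h)" using split[OF k] by blast
    then show ?thesis
      using C0_D(2,3)[OF assms(5), of g] C0_D(2,3)[OF assms(6), of h]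
      by (simp add: norm_mult mult_le_one)
  qed
  show cont: "continuous_map (subtopology (gtop G) ?P) euclidean (\<lambda>k. the (c k))"
    unfolding continuous_map_def
  proof (intro conjI allI impI)
    show "(\<lambda>k. the (c k)) \<in> topspace (subtopology (gtop G) ?P) \<rightarrow> topspace euclidean" by simp
    fix W :: "complex set" assume "openin euclidean W"
    then have W: "open W" by simp
    have "openin (gtop G) {k \<in> ?P. the (c k) \<in> W}"
    proof (subst openin_subopen, intro ballI)
      fix k assume k: "k \<in> {k \<in> ?P. the (c k) \<in> W}"
      then obtain g h where gh: "g \<in> U" "h \<in> V" "src G g = rng G h" "k = gmult G g h"
        "the (c k) = the (a g) * the (b h)" using split[of k] by blast
      have "open ((\<lambda>p. fst p * snd p :: complex) -` W)"
        using W by (intro open_vimage) (auto intro!: continuous_intros)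
      moreover have "(the (a g), the (b h)) \<in> (\<lambda>p. fst p * snd p) -` W" using gh k by simp
      ultimately obtain A B where AB: "open A" "open B" "(the (a g), the (b h)) \<in> A \<times> B"
        "A \<times> B \<subseteq> (\<lambda>p. fst p * snd p) -` W" by (rule open_prod_elim)
      let ?A = "{x \<in> U. the (a x) \<in> A}" and ?B = "{y \<in> V. the (b y) \<in> B}"
      have "openin (gtop G) (set_prod G ?A ?B)"
        using assms(1) openin_C0_preimage[OF assms(5) Uo(1) AB(1)]
          openin_C0_preimage[OF assms(6) Uo(2) AB(2)]
        by (simp add: open_operations_def)
      moreover have "k \<in> set_prod G ?A ?B" using gh AB(3) by (auto intro: set_prodI)
      moreover have "set_prod G ?A ?B \<subseteq> {k \<in> ?P. the (c k) \<in> W}"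
      proof
        fix z assume "z \<in> set_prod G ?A ?B"
        then obtain x y where xy: "x \<in> ?A" "y \<in> ?B" "src G x = rng G y" "z = gmult G x y"
          by (auto simp: set_prod_def)
        then have "(the (a x), the (b y)) \<in> A \<times> B" by simp
        then have "the (a x) * the (b y) \<in> W" using AB(4) by fastforce
        then show "z \<in> {k \<in> ?P. the (c k) \<in> W}" using xy c_mult by (auto intro: set_prodI)
      qed
      ultimately show "\<exists>O'. openin (gtop G) O' \<and> k \<in> O' \<and> O' \<subseteq> {k \<in> ?P. the (c k) \<in> W}"
        by blast
    qed
    moreover have "{k \<in> topspace (subtopology (gtop G) ?P). the (c k) \<in> W} = {k \<in> ?P. the (c k) \<in> W}"
      using P by auto
    moreover have "openin (gtop G) ?P" using assms(1) Uo by (simp add: open_operations_def)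
    ultimately show "openin (subtopology (gtop G) ?P)
        {k \<in> topspace (subtopology (gtop G) ?P). the (c k) \<in> W}"
      by (simp add: openin_open_subtopology)
  qed
  show "compactin (gtop G) {k \<in> ?P. norm (the (c k)) \<ge> \<epsilon>}" if "\<epsilon> > 0" for \<epsilon>
  proof -
    let ?K = "{g \<in> U. norm (the (a g)) \<ge> \<epsilon>}" and ?L = "{h \<in> V. norm (the (b h)) \<ge> \<epsilon>}"
    have "compactin (gtop G) ?K" "compactin (gtop G) ?L"
      using assms(5,6) that by (simp_all add: C0_def)
    then have "compactin (gtop G) (set_prod G ?K ?L)" by (rule compactin_set_prod[OF assms(1,2)])
    moreover have "set_prod G ?K ?L \<subseteq> ?P" by (auto simp: set_prod_def)
    ultimately have "compactin (subtopology (gtop G) ?P) (set_prod G ?K ?L)"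
      by (simp add: compactin_subtopology)
    moreover have "closedin (subtopology (gtop G) ?P) {k \<in> ?P. the (c k) \<in> - ball 0 \<epsilon>}"
      using cont P by (intro closedin_preimage_subtopology) auto
    moreover have "{k \<in> ?P. the (c k) \<in> - ball 0 \<epsilon>} \<subseteq> set_prod G ?K ?L"
    proof
      fix k assume k: "k \<in> {k \<in> ?P. the (c k) \<in> - ball 0 \<epsilon>}"
      then obtain g h where gh: "g \<in> U" "h \<in> V" "src G g = rng G h" "k = gmult G g h"
        "the (c k) = the (a g) * the (b h)" using split[of k] by blast
      have n: "\<epsilon> \<le> norm (the (a g)) * norm (the (b h))"
        using k gh(5) by (simp add: norm_mult)
      have "norm (the (a g)) * norm (the (b h)) \<le> norm (the (a g))"
        "norm (the (a g)) * norm (the (b h)) \<le> norm (the (b h))"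
        using C0_D(2)[OF assms(5) gh(1)] C0_D(2)[OF assms(6) gh(2)]
        by (simp_all add: mult_left_le mult_left_le_one_le)
      then show "k \<in> set_prod G ?K ?L" using gh n by (auto intro!: set_prodI)
    qed
    ultimately have "compactin (subtopology (gtop G) ?P) {k \<in> ?P. the (c k) \<in> - ball 0 \<epsilon>}"
      using closed_compactin by blast
    then show ?thesis by (simp add: compactin_subtopology not_less)
  qed
qed

lemma bumpy_semigroup_C0:
  assumes "open_operations" "Hausdorff_space (subtopology (gtop G) (unit_space G))"
    "locally_compact G"
  shows "bumpy_semigroup G punctured_disc (\<Union>U\<in>open_bisections G. C0 G U)"
proof -
  let ?S = "\<Union>U\<in>open_bisections G. C0 G U"
  have "?S \<subseteq> partial_functions punctured_disc (open_bisections G)"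
    by (auto simp: partial_functions_def C0_def)
  moreover have "pmult G punctured_disc a b \<in> ?S" if "a \<in> ?S" "b \<in> ?S" for a b
  proof -
    obtain U V where UV: "U \<in> open_bisections G" "V \<in> open_bisections G" "a \<in> C0 G U" "b \<in> C0 G V"
      using \<open>a \<in> ?S\<close> \<open>b \<in> ?S\<close> by blast
    then have "set_prod G U V \<in> open_bisections G"
      using assms(1) bisection_set_prod by (simp add: open_bisections_def open_operations_def)
    then show ?thesis using C0_pmult[OF assms(1,2) UV] by blast
  qed
  ultimately show ?thesis
    using one_proper_C0 urysohn_C0[OF assms] involutive_C0[OF assms(1)]
    by (simp add: bumpy_semigroup_def bumpy_def)
qed

end

theorem theorem3p3:
  fixes G :: "'g topologised_groupoid"
  assumes "groupoid G"
    and "Hausdorff_space (subtopology (gtop G) (unit_space G))"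
  shows "(\<forall>(Y :: 'y monoid) S. monoid Y \<longrightarrow> one_cancellative Y \<longrightarrow> bumpy_semigroup G Y S
            \<longrightarrow> locally_compact G \<and> etale G) \<and>
         (locally_compact G \<and> etale G
            \<longrightarrow> bumpy_semigroup G punctured_disc (\<Union>U\<in>open_bisections G. C0 G U))"
proof (intro conjI allI impI)
  fix Y :: "'y monoid" and S
  assume "monoid Y" and S: "bumpy_semigroup G Y S"
  have "groupoid.open_operations G"
    using groupoid.open_operations_if_bumpy_semigroup[OF assms(1) S] .
  then show "locally_compact G" "etale G"
    using groupoid.locally_compact_if_unit_space[OF assms(1)] assms(2)
      groupoid.locally_compact_unit_space_if_bumpy_semigroup[OF assms(1) \<open>monoid Y\<close> S]
      groupoid.etale_if_open_operations[OF assms(1)] by blast+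
next
  assume "locally_compact G \<and> etale G"
  then show "bumpy_semigroup G punctured_disc (\<Union>U\<in>open_bisections G. C0 G U)"
    using groupoid.bumpy_semigroup_C0[OF assms(1) _ assms(2)]
      groupoid.open_operations_if_etale[OF assms(1)] by blast
qed

end
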